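(* Let $\mathcal X,\mathcal Y$ be finite-dimensional Euclidean spaces, $A:\mathcal X\to\mathcal Y$ a linear map with adjoint $A^*$, $b\in\mathcal Y$, $\kappa:\mathcal X\to\mathbb R\cup\{+\infty\}$ a closed gauge, and $\rho:\mathcal Y\to\mathbb R\cup\{+\infty\}$ a closed gauge. Let $0\le\sigma<\rho(b)$, and if $\sigma=0$ assume in addition that $\rho^{-1}(0)=\{0\}$. Let $\mathcal C_0=\{u\in\mathcal Y\mid\rho(b-u)\le\sigma\}$. Suppose that $$\operatorname{ri}\operatorname{dom}\kappa\cap A^{-1}\operatorname{ri}\mathcal C_0\neq\emptyset\quad\text{and}\quad\operatorname{ri}\operatorname{dom}\kappa^\circ\cap A^*\operatorname{ri}\mathcal C_0'\neq\emptyset.$$ Then the optimal values of the two problems $$\min_{x}\ \kappa(x)\ \text{ subject to }\ \rho(b-Ax)\le\sigma\qquad\text{and}\qquad\min_{y}\ \kappa^\circ(A^*y)\ \text{ subject to }\ \langle y,b\rangle-\sigma\rho^\circ(y)\ge1$$ are attained, and their product is $1$.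
   Context: A gauge is a nonnegative, positively homogeneous convex function $\kappa$ with values in $\mathbb R\cup\{+\infty\}$ and $\kappa(0)=0$; $\operatorname{dom}\kappa=\{x\mid\kappa(x)<\infty\}$. It is closed if its epigraph is closed (equivalently, it is lower semicontinuous). Its polar is the gauge $\kappa^\circ(y)=\inf\{\mu>0\mid\langle x,y\rangle\le\mu\kappa(x)\ \forall x\}$ (with $\inf\emptyset=+\infty$). The antipolar of a set $\mathcal D$ is $\mathcal D'=\{y\mid\langle y,x\rangle\ge1\ \forall x\in\mathcal D\}$. $\operatorname{ri}$ denotes relative interior; $A^{-1}\mathcal D$ is the preimage of $\mathcal D$ under $A$. *)

theory Defs
  imports "HOL-Analysis.Analysis"
begin

text \<open>The library constant \<open>epigraph\<close> covers real-valued functions only; as usual, the epigraph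
  of an extended-real-valued function is a subset of \<open>'a \<times> real\<close>.\<close>

definition ereal_epigraph :: "('a \<Rightarrow> ereal) \<Rightarrow> ('a \<times> real) set" where
  "ereal_epigraph f = {(x, r). f x \<le> ereal r}"

definition effective_domain :: "('a \<Rightarrow> ereal) \<Rightarrow> 'a set" where
  "effective_domain f = {x. f x < \<infinity>}"

text \<open>Convexity of an extended-real-valued function is convexity of its epigraph. Nonnegativity
  excludes the value \<open>-\<infinity>\<close>. The name \<open>gauge\<close> is taken by Henstock-Kurzweil integration.\<close>

definition is_gauge :: "('a::real_vector \<Rightarrow> ereal) \<Rightarrow> bool" where
  "is_gauge \<kappa> \<longleftrightarrow>
     (\<forall>x. 0 \<le> \<kappa> x) \<and>
     (\<forall>x. \<forall>t::real. 0 < t \<longrightarrow> \<kappa> (t *\<^sub>R x) = ereal t * \<kappa> x) \<and>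
     convex (ereal_epigraph \<kappa>) \<and>
     \<kappa> 0 = 0"

definition closed_gauge :: "('a::real_normed_vector \<Rightarrow> ereal) \<Rightarrow> bool" where
  "closed_gauge \<kappa> \<longleftrightarrow> is_gauge \<kappa> \<and> closed (ereal_epigraph \<kappa>)"

text \<open>The infimum is taken in \<open>ereal\<close>, so it is \<open>\<infinity>\<close> when no \<open>\<mu>\<close> qualifies.\<close>

definition polar_gauge :: "('a::real_inner \<Rightarrow> ereal) \<Rightarrow> 'a \<Rightarrow> ereal" where
  "polar_gauge \<kappa> y =
     Inf {ereal \<mu> | \<mu>::real. 0 < \<mu> \<and> (\<forall>x. ereal (x \<bullet> y) \<le> ereal \<mu> * \<kappa> x)}"

definition antipolar :: "'a::real_inner set \<Rightarrow> 'a set" where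
  "antipolar D = {y. \<forall>x\<in>D. 1 \<le> y \<bullet> x}"

definition residual_set :: "'b::real_inner \<Rightarrow> ('b \<Rightarrow> ereal) \<Rightarrow> real \<Rightarrow> 'b set" where
  "residual_set b \<rho> \<sigma> = {u. \<rho> (b - u) \<le> ereal \<sigma>}"

definition primal_feasible ::
    "('a::real_inner \<Rightarrow> 'b::real_inner) \<Rightarrow> 'b \<Rightarrow> ('b \<Rightarrow> ereal) \<Rightarrow> real \<Rightarrow> 'a set" where
  "primal_feasible A b \<rho> \<sigma> = {x. \<rho> (b - A x) \<le> ereal \<sigma>}"

text \<open>If \<open>\<sigma> > 0\<close> and \<open>polar_gauge \<rho> y = \<infinity>\<close>, the left-hand side is \<open>-\<infinity>\<close> and \<open>y\<close> is infeasible.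
  For \<open>\<sigma> = 0\<close> the \<open>ereal\<close> convention \<open>0 * \<infinity> = 0\<close> could matter, but the polar of a closed gauge
  on a Euclidean space that vanishes only at the origin is finite everywhere.\<close>

definition dual_feasible :: "'b::real_inner \<Rightarrow> ('b \<Rightarrow> ereal) \<Rightarrow> real \<Rightarrow> 'b set" where
  "dual_feasible b \<rho> \<sigma> = {y. ereal (y \<bullet> b) - ereal \<sigma> * polar_gauge \<rho> y \<ge> 1}"

definition optimal_value :: "('a \<Rightarrow> ereal) \<Rightarrow> 'a set \<Rightarrow> ereal" where
  "optimal_value f F = (INF x\<in>F. f x)"

definition optimal_value_attained :: "('a \<Rightarrow> ereal) \<Rightarrow> 'a set \<Rightarrow> bool" where
  "optimal_value_attained f F \<longleftrightarrow> (\<exists>x\<in>F. f x = optimal_value f F)"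

end

theory Submission
  imports Defs
begin

text \<open>
  Write \<open>C\<close> for the residual set; the dual constraint says exactly \<open>y \<in> antipolar C\<close>, so for feasible
  \<open>x\<close> and \<open>y\<close> weak duality reads \<open>1 \<le> y \<bullet> A x \<le> polar_gauge \<kappa> (adjoint A y) * \<kappa> x\<close>, and the optimal
  value \<open>p\<close> of the primal problem is positive and finite. The first interiority condition
  makes the value function of the perturbed primal problem subdifferentiable at the origin; a
  subgradient \<open>z\<close> satisfies \<open>z \<bullet> A x \<le> \<kappa> x\<close> for all \<open>x\<close> and \<open>z \<bullet> u \<ge> p\<close> on \<open>C\<close>, so \<open>z / p\<close> is dual
  optimal with value \<open>1 / p\<close>. The same argument applied to the dual problem yields \<open>x\<close> with
  \<open>\<kappa> x \<le> p\<close> (by the bipolar theorem) and \<open>A x\<close> in the antipolar of \<open>antipolar C\<close>. As \<open>C\<close> is closed and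
  omits the origin, that bi-antipolar is the union of the sets \<open>l *\<^sub>R C\<close> over \<open>l \<ge> 1\<close>, so shrinking
  \<open>x\<close> makes it feasible without increasing \<open>\<kappa> x\<close>.
\<close>

section \<open>Gauges and their polars\<close>

lemma convex_effective_domain:
  assumes "convex (ereal_epigraph f)"
  shows "convex (effective_domain f)"
proof -
  have "effective_domain f = fst ` ereal_epigraph f"
  proof (intro subset_antisym subsetI)
    fix x assume "x \<in> effective_domain f"
    then obtain r where "f x \<le> ereal r"
      by (cases "f x") (auto simp: effective_domain_def)
    then show "x \<in> fst ` ereal_epigraph f"
      by (force simp: ereal_epigraph_def)
  qed (auto simp: ereal_epigraph_def effective_domain_def)
  with assms show ?thesis
    by (simp add: convex_linear_image linear_fst)
qed

lemma is_gauge_scale_le: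
  assumes "is_gauge \<kappa>" "0 < t" "\<kappa> x \<le> ereal r"
  shows "\<kappa> (t *\<^sub>R x) \<le> ereal (t * r)"
proof -
  have "\<kappa> (t *\<^sub>R x) = ereal t * \<kappa> x"
    using assms by (simp add: is_gauge_def)
  also have "\<dots> \<le> ereal t * ereal r"
    using assms by (intro ereal_mult_left_mono) auto
  finally show ?thesis by simp
qed

lemma polar_gauge_nonneg: "0 \<le> polar_gauge \<kappa> y"
  unfolding polar_gauge_def by (rule Inf_greatest) auto

text \<open>Quantifying over real bounds \<open>k\<close> of \<open>\<kappa> x\<close> keeps the
  arithmetic in the reals and avoids products such as \<open>0 * \<infinity>\<close>. The infimum
  ranges over positive \<open>\<mu>\<close> only and need not be attained, so both directions pass
  through \<open>r + e\<close> with \<open>e > 0\<close>.\<close>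

lemma polar_gauge_le_iff:
  assumes "\<And>x. 0 \<le> \<kappa> x"
  shows "polar_gauge \<kappa> y \<le> ereal r \<longleftrightarrow>
    0 \<le> r \<and> (\<forall>x k. \<kappa> x \<le> ereal k \<longrightarrow> x \<bullet> y \<le> r * k)"
proof (intro iffI conjI allI impI)
  assume le: "polar_gauge \<kappa> y \<le> ereal r"
  then show "0 \<le> r"
    using order_trans[OF polar_gauge_nonneg le] by simp
  fix x k assume k: "\<kappa> x \<le> ereal k"
  then have "0 \<le> k"
    using order_trans[OF assms k] by simp
  have bound: "x \<bullet> y \<le> (r + e) * k" if "e > 0" for e
  proof -
    have "polar_gauge \<kappa> y < ereal (r + e)"
      using le that by (simp add: le_less_trans)
    then obtain \<mu> where \<mu>: "0 < \<mu>" "\<mu> < r + e" "ereal (x \<bullet> y) \<le> ereal \<mu> * \<kappa> x"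
      unfolding polar_gauge_def Inf_less_iff by auto
    have "ereal \<mu> * \<kappa> x \<le> ereal \<mu> * ereal k"
      using \<mu> k by (intro ereal_mult_left_mono) auto
    with \<mu> have "x \<bullet> y \<le> \<mu> * k"
      by (metis ereal_less_eq(3) order_trans times_ereal.simps(1))
    also have "\<dots> \<le> (r + e) * k"
      using \<mu> \<open>0 \<le> k\<close> by (intro mult_right_mono) auto
    finally show ?thesis .
  qed
  \<comment> \<open>The slack \<open>e = d / (k + 1)\<close> satisfies \<open>e * k \<le> d\<close>;
    the \<open>+ 1\<close> covers \<open>k = 0\<close>.\<close>
  have "x \<bullet> y \<le> r * k + d" if "d > 0" for d
  proof -
    have "x \<bullet> y \<le> (r + d / (k + 1)) * k"
      using bound[of "d / (k + 1)"] that \<open>0 \<le> k\<close> by simp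
    also have "\<dots> \<le> r * k + d"
      using that \<open>0 \<le> k\<close> by (simp add: field_simps)
    finally show ?thesis .
  qed
  then show "x \<bullet> y \<le> r * k"
    by (rule field_le_epsilon)
next
  assume R: "0 \<le> r \<and> (\<forall>x k. \<kappa> x \<le> ereal k \<longrightarrow> x \<bullet> y \<le> r * k)"
  show "polar_gauge \<kappa> y \<le> ereal r"
  proof (rule ereal_le_epsilon2)
    fix e :: real assume "0 < e"
    have "ereal (x \<bullet> y) \<le> ereal (r + e) * \<kappa> x" for x
    proof (cases "\<kappa> x")
      case (real k)
      then have "x \<bullet> y \<le> r * k" "0 \<le> k"
        using R assms[of x] by auto
      then show ?thesis
        using real \<open>0 < e\<close> by (auto simp: distrib_right intro: order_trans)
    next
      case PInf
      then show ?thesis using R \<open>0 < e\<close> by simp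
    next
      case MInf
      then show ?thesis using assms[of x] by simp
    qed
    then have "ereal (r + e) \<in> {ereal \<mu> | \<mu>. 0 < \<mu> \<and> (\<forall>x. ereal (x \<bullet> y) \<le> ereal \<mu> * \<kappa> x)}"
      using R \<open>0 < e\<close> by auto
    then show "polar_gauge \<kappa> y \<le> ereal r + ereal e"
      unfolding polar_gauge_def by (auto intro: Inf_lower)
  qed
qed

lemma inner_le_polar_gauge:
  assumes "\<And>x. 0 \<le> \<kappa> x" "polar_gauge \<kappa> y \<le> ereal r" "\<kappa> x \<le> ereal k"
  shows "x \<bullet> y \<le> r * k"
  using assms polar_gauge_le_iff[of \<kappa> y r] by blast

text \<open>Makes the duality argument for \<open>\<kappa>\<close> applicable to the dual objective
  as well.\<close>

lemma is_gauge_polar_gauge: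
  assumes "is_gauge \<kappa>"
  shows "is_gauge (polar_gauge \<kappa>)"
proof -
  have nn: "\<And>x. 0 \<le> \<kappa> x"
    using assms by (auto simp: is_gauge_def)
  note iff = polar_gauge_le_iff[of \<kappa>, OF nn]
  have scale: "polar_gauge \<kappa> (t *\<^sub>R y) \<le> ereal t * polar_gauge \<kappa> y" if "0 < t" for t y
  proof (cases "polar_gauge \<kappa> y")
    case (real r)
    then have "0 \<le> r" and r: "\<And>x k. \<kappa> x \<le> ereal k \<Longrightarrow> x \<bullet> y \<le> r * k"
      using iff[of y r] by auto
    have "polar_gauge \<kappa> (t *\<^sub>R y) \<le> ereal (t * r)"
      unfolding iff using \<open>0 < t\<close> \<open>0 \<le> r\<close> r by (auto simp: mult.assoc intro!: mult_left_mono)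
    with real show ?thesis by simp
  next
    case PInf
    then show ?thesis using that by simp
  next
    case MInf
    then show ?thesis using polar_gauge_nonneg[of \<kappa> y] by simp
  qed
  \<comment> \<open>The reverse inequality is \<open>scale\<close> with factor \<open>1 / t\<close>
    at the point \<open>t *\<^sub>R y\<close>.\<close>
  have homogeneous: "polar_gauge \<kappa> (t *\<^sub>R y) = ereal t * polar_gauge \<kappa> y" if "0 < t" for t y
  proof (rule antisym[OF scale[OF that]])
    have "polar_gauge \<kappa> y \<le> ereal (1 / t) * polar_gauge \<kappa> (t *\<^sub>R y)"
      using scale[of "1 / t" "t *\<^sub>R y"] that by simp
    then have "ereal t * polar_gauge \<kappa> y \<le> ereal t * (ereal (1 / t) * polar_gauge \<kappa> (t *\<^sub>R y))"
      using that by (intro ereal_mult_left_mono) auto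
    also have "\<dots> = polar_gauge \<kappa> (t *\<^sub>R y)"
      using that by (simp flip: mult.assoc one_ereal_def)
    finally show "ereal t * polar_gauge \<kappa> y \<le> polar_gauge \<kappa> (t *\<^sub>R y)" .
  qed
  have "convex (ereal_epigraph (polar_gauge \<kappa>))"
  proof (rule convexI)
    fix p q :: "'a \<times> real" and u v :: real
    assume pq: "p \<in> ereal_epigraph (polar_gauge \<kappa>)" "q \<in> ereal_epigraph (polar_gauge \<kappa>)"
      and uv: "0 \<le> u" "0 \<le> v" "u + v = 1"
    have "x \<bullet> (u *\<^sub>R fst p + v *\<^sub>R fst q) \<le> (u * snd p + v * snd q) * k"
      if "\<kappa> x \<le> ereal k" for x k
    proof -
      have "x \<bullet> fst p \<le> snd p * k" "x \<bullet> fst q \<le> snd q * k"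
        using pq that by (auto simp: ereal_epigraph_def iff)
      then have "u * (x \<bullet> fst p) + v * (x \<bullet> fst q) \<le> u * (snd p * k) + v * (snd q * k)"
        using uv by (intro add_mono mult_left_mono) auto
      then show ?thesis by (simp add: algebra_simps)
    qed
    moreover have "0 \<le> u * snd p + v * snd q"
      using pq uv by (auto simp: ereal_epigraph_def iff)
    ultimately have "polar_gauge \<kappa> (u *\<^sub>R fst p + v *\<^sub>R fst q) \<le> ereal (u * snd p + v * snd q)"
      unfolding iff by blast
    then show "u *\<^sub>R p + v *\<^sub>R q \<in> ereal_epigraph (polar_gauge \<kappa>)"
      by (cases p; cases q) (simp add: ereal_epigraph_def)
  qed
  moreover have "polar_gauge \<kappa> 0 = 0"
    using iff[of 0 0] polar_gauge_nonneg[of \<kappa> 0] by (simp add: antisym flip: zero_ereal_def)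
  ultimately show ?thesis
    unfolding is_gauge_def using polar_gauge_nonneg homogeneous by blast
qed

text \<open>By homogeneity a single sublevel set at a positive height determines the polar. Height
  \<open>\<sigma>\<close> serves the dual constraint, height 1 the bipolar theorem.\<close>

lemma polar_gauge_le_sublevel_iff:
  assumes "is_gauge \<kappa>" "0 < c"
  shows "polar_gauge \<kappa> y \<le> ereal (s / c) \<longleftrightarrow> (\<forall>x. \<kappa> x \<le> ereal c \<longrightarrow> x \<bullet> y \<le> s)"
proof
  have nn: "\<And>x. 0 \<le> \<kappa> x" and z: "\<kappa> 0 = 0"
    using assms by (auto simp: is_gauge_def)
  note iff = polar_gauge_le_iff[of \<kappa>, OF nn]
  show "\<forall>x. \<kappa> x \<le> ereal c \<longrightarrow> x \<bullet> y \<le> s" if "polar_gauge \<kappa> y \<le> ereal (s / c)"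
    using inner_le_polar_gauge[of \<kappa>, OF nn that, of _ c] \<open>0 < c\<close> by simp
  assume S: "\<forall>x. \<kappa> x \<le> ereal c \<longrightarrow> x \<bullet> y \<le> s"
  then have "0 \<le> s"
    using z \<open>0 < c\<close> by (force dest: spec[of _ 0])
  have "x \<bullet> y \<le> s / c * k" if k: "\<kappa> x \<le> ereal k" for x k
  proof -
    have "0 \<le> k"
      using order_trans[OF nn k] by simp
    \<comment> \<open>Moving \<open>x\<close> to height \<open>c\<close> means scaling by
      \<open>c / h\<close>, which requires \<open>h > 0\<close>. The case \<open>k = 0\<close> is
      then reached by letting \<open>h\<close> decrease to \<open>k\<close>.\<close>
    have pos: "x \<bullet> y \<le> s / c * h" if "h > 0" "k \<le> h" for h
    proof -
      have "\<kappa> x \<le> ereal h"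
        using k that by (meson ereal_less_eq(3) order_trans)
      then have "\<kappa> ((c / h) *\<^sub>R x) \<le> ereal c"
        using is_gauge_scale_le[OF assms(1), of "c / h" x h] that \<open>0 < c\<close> by simp
      with S have "c / h * (x \<bullet> y) \<le> s"
        by fastforce
      then show ?thesis
        using that \<open>0 < c\<close> by (simp add: field_simps)
    qed
    have "x \<bullet> y \<le> s / c * k + d" if "d > 0" for d
    proof -
      have "x \<bullet> y \<le> s / c * (k + d / (s / c + 1))"
        using that \<open>0 \<le> k\<close> \<open>0 \<le> s\<close> \<open>0 < c\<close>
        by (intro pos) (auto intro!: add_nonneg_pos divide_pos_pos)
      also have "\<dots> = s / c * k + (s / c) / (s / c + 1) * d"
        by (simp add: algebra_simps)
      also have "\<dots> \<le> s / c * k + 1 * d"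
        using that \<open>0 \<le> s\<close> \<open>0 < c\<close> by (intro add_left_mono mult_right_mono) (auto simp: divide_le_eq distrib_left add_nonneg_pos)
      finally show ?thesis by simp
    qed
    then show ?thesis
      by (rule field_le_epsilon)
  qed
  then show "polar_gauge \<kappa> y \<le> ereal (s / c)"
    unfolding iff using \<open>0 \<le> s\<close> \<open>0 < c\<close> by auto
qed

lemma closed_gauge_sublevel:
  assumes "closed_gauge \<kappa>"
  shows "closed {x. \<kappa> x \<le> ereal c}" "convex {x. \<kappa> x \<le> ereal c}"
proof -
  have eq: "{x. \<kappa> x \<le> ereal c} = (\<lambda>x. (x, c)) -` ereal_epigraph \<kappa>"
    by (auto simp: ereal_epigraph_def)
  show "closed {x. \<kappa> x \<le> ereal c}"
    unfolding eq using assms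
    by (intro closed_vimage continuous_intros) (auto simp: closed_gauge_def)
  have *: "u *\<^sub>R x + v *\<^sub>R y \<in> {x. \<kappa> x \<le> ereal c}"
    if "\<kappa> x \<le> ereal c" "\<kappa> y \<le> ereal c" "0 \<le> u" "0 \<le> v" "u + v = 1" for x y u v
  proof -
    have "u *\<^sub>R (x, c) + v *\<^sub>R (y, c) \<in> ereal_epigraph \<kappa>"
      using assms that unfolding closed_gauge_def is_gauge_def
      by (intro convexD) (auto simp: ereal_epigraph_def)
    then show ?thesis
      using that by (simp add: ereal_epigraph_def flip: distrib_right)
  qed
  show "convex {x. \<kappa> x \<le> ereal c}"
    by (rule convexI) (use * in auto)
qed

text \<open>The half of the bipolar theorem that uses closedness: a point outside the unit sublevel
  set is strictly separated from it, and the negated normal violates the assumed bound.\<close>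

lemma le_one_of_inner_le_polar_gauge:
  fixes \<kappa> :: "'a::euclidean_space \<Rightarrow> ereal"
  assumes "closed_gauge \<kappa>" and x: "\<And>w. ereal (x \<bullet> w) \<le> polar_gauge \<kappa> w"
  shows "\<kappa> x \<le> 1"
proof (rule ccontr)
  assume "\<not> \<kappa> x \<le> 1"
  then have "x \<notin> {x. \<kappa> x \<le> ereal 1}"
    by (simp add: one_ereal_def)
  then obtain a \<beta> where a: "a \<bullet> x < \<beta>" "\<And>z. \<kappa> z \<le> ereal 1 \<Longrightarrow> a \<bullet> z > \<beta>"
    using separating_hyperplane_closed_point[OF closed_gauge_sublevel(2,1)[OF assms(1), of 1], of x]
    by auto
  have "polar_gauge \<kappa> (- a) \<le> ereal (- \<beta> / 1)"
    using assms(1) a(2) by (subst polar_gauge_le_sublevel_iff)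
      (auto simp: closed_gauge_def inner_commute intro: less_imp_le)
  with x[of "- a"] have "ereal (x \<bullet> (- a)) \<le> ereal (- \<beta>)"
    by (metis div_by_1 order_trans)
  with a(1) show False
    by (simp add: inner_commute)
qed

section \<open>Antipolars\<close>

lemma convex_antipolar: "convex (antipolar D)"
proof (rule convexI)
  fix y z :: 'a and u v :: real
  assume *: "y \<in> antipolar D" "z \<in> antipolar D" "0 \<le> u" "0 \<le> v" "u + v = 1"
  show "u *\<^sub>R y + v *\<^sub>R z \<in> antipolar D"
    unfolding antipolar_def
  proof (intro CollectI ballI)
    fix x assume "x \<in> D"
    with * have "u * 1 + v * 1 \<le> u * (y \<bullet> x) + v * (z \<bullet> x)"
      by (intro add_mono mult_left_mono) (auto simp: antipolar_def)
    with * show "1 \<le> (u *\<^sub>R y + v *\<^sub>R z) \<bullet> x"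
      by (simp add: inner_add_left)
  qed
qed

text \<open>The points \<open>l *\<^sub>R c\<close> with \<open>l \<ge> 1\<close> and \<open>c \<in> C\<close> form a closed set because \<open>C\<close> stays away from
  the origin: if \<open>l\<^sub>n *\<^sub>R c\<^sub>n\<close> converges, then \<open>l\<^sub>n\<close> is bounded.\<close>

lemma closed_scaled_up:
  fixes C :: "'a::euclidean_space set"
  assumes "closed C" "0 \<notin> C"
  shows "closed {l *\<^sub>R c | l c. 1 \<le> l \<and> c \<in> C}"
  unfolding closed_sequential_limits
proof (intro allI impI, elim conjE)
  fix h u
  assume "\<forall>n. h n \<in> {l *\<^sub>R c | l c. 1 \<le> l \<and> c \<in> C}" and lim: "h \<longlonglongrightarrow> u"
  then obtain l c where h: "\<And>n. h n = l n *\<^sub>R c n" and l: "\<And>n. 1 \<le> l n" and c: "\<And>n. c n \<in> C"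
    by (simp add: choice_iff) metis
  obtain d where "d > 0" and d: "\<And>x. x \<in> C \<Longrightarrow> d \<le> dist 0 x"
    using separate_point_closed[OF assms] by blast
  have "bounded (range h)"
    using lim by (rule convergent_imp_bounded)
  then obtain K where K: "\<And>n. norm (h n) \<le> K"
    by (auto simp: bounded_iff)
  have "l n \<in> {1..K / d}" for n
  proof -
    have "l n * d \<le> l n * norm (c n)"
      using l[of n] d[OF c, of n] by (intro mult_left_mono) auto
    also have "\<dots> \<le> K"
      using K[of n] l[of n] by (simp add: h)
    finally show ?thesis
      using l[of n] \<open>d > 0\<close> by (simp add: field_simps)
  qed
  then obtain l' r where l': "l' \<in> {1..K / d}" "strict_mono r" "(l \<circ> r) \<longlonglongrightarrow> l'"
    using compact_Icc[of 1 "K / d"] unfolding compact_def by metis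
  \<comment> \<open>Dividing by the convergent factors, which stay at least 1, recovers points of
    \<open>C\<close>, so their limit lies in \<open>C\<close>.\<close>
  have "(\<lambda>n. inverse (l (r n)) *\<^sub>R h (r n)) \<longlonglongrightarrow> inverse l' *\<^sub>R u"
    using l' LIMSEQ_subseq_LIMSEQ[OF lim l'(2)]
    by (intro tendsto_intros) (auto simp: o_def)
  moreover have "inverse (l (r n)) *\<^sub>R h (r n) = c (r n)" for n
    using l[of "r n"] by (simp add: h)
  ultimately have "inverse l' *\<^sub>R u \<in> C"
    using assms(1) c by (metis (no_types, lifting) closed_sequentially)
  moreover have "u = l' *\<^sub>R (inverse l' *\<^sub>R u)"
    using l' by simp
  ultimately show "u \<in> {l *\<^sub>R c | l c. 1 \<le> l \<and> c \<in> C}"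
    using l'(1) by (auto simp del: scaleR_scaleR)
qed

text \<open>The factors average to some \<open>s \<ge> 1\<close>; dividing by \<open>s\<close>
  leaves a convex combination of the two points of \<open>C\<close>, with weights
  \<open>u * l / s\<close> and \<open>v * m / s\<close>.\<close>

lemma convex_scaled_up:
  assumes "convex C"
  shows "convex {l *\<^sub>R c | l c. 1 \<le> l \<and> c \<in> C}"
proof (rule convexI, safe)
  fix l m u v :: real and c d
  assume *: "1 \<le> l" "c \<in> C" "1 \<le> m" "d \<in> C" "0 \<le> u" "0 \<le> v" "u + v = 1"
  define s where "s = u * l + v * m"
  have "u * 1 + v * 1 \<le> s"
    unfolding s_def using * by (intro add_mono mult_left_mono) auto
  then have s: "1 \<le> s"
    using * by simp
  have "(u * l / s) *\<^sub>R c + (v * m / s) *\<^sub>R d \<in> C"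
    using * s by (intro convexD[OF assms]) (auto simp: s_def simp flip: add_divide_distrib)
  moreover have "u *\<^sub>R l *\<^sub>R c + v *\<^sub>R m *\<^sub>R d = s *\<^sub>R ((u * l / s) *\<^sub>R c + (v * m / s) *\<^sub>R d)"
    using s by (simp add: scaleR_add_right)
  ultimately show "\<exists>k e. u *\<^sub>R l *\<^sub>R c + v *\<^sub>R m *\<^sub>R d = k *\<^sub>R e \<and> 1 \<le> k \<and> e \<in> C"
    using s by blast
qed

text \<open>A point outside the closed convex set of upward multiples is strictly separated from it.
  If \<beta> is positive, the normal divided by \<beta> lies in the antipolar and gives a
  contradiction. Otherwise the normal is a recession direction of the antipolar, and moving far from
  \<open>y0\<close> along it does.\<close>

lemma antipolar_antipolar_subset:
  fixes C :: "'a::euclidean_space set"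
  assumes "closed C" "convex C" "0 \<notin> C" and y0: "y0 \<in> antipolar C"
  shows "antipolar (antipolar C) \<subseteq> {l *\<^sub>R c | l c. 1 \<le> l \<and> c \<in> C}"
proof (rule subsetI, rule ccontr)
  fix u assume u: "u \<in> antipolar (antipolar C)" and "u \<notin> {l *\<^sub>R c | l c. 1 \<le> l \<and> c \<in> C}"
  then obtain a \<beta> where a: "a \<bullet> u < \<beta>" and sep: "\<forall>z\<in>{l *\<^sub>R c | l c. 1 \<le> l \<and> c \<in> C}. a \<bullet> z > \<beta>"
    using separating_hyperplane_closed_point[OF convex_scaled_up[OF assms(2)] closed_scaled_up[OF assms(1,3)], of u]
    by blast
  have gt: "\<beta> < l * (a \<bullet> c)" if "1 \<le> l" "c \<in> C" for l c
  proof -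
    have "\<beta> < a \<bullet> (l *\<^sub>R c)"
      using sep that by blast
    then show ?thesis by simp
  qed
  show False
  proof (cases "\<beta> > 0")
    case True
    have "(1 / \<beta>) *\<^sub>R a \<in> antipolar C"
      using gt[of 1] True by (auto simp: antipolar_def field_simps intro: less_imp_le)
    with u have "1 \<le> u \<bullet> ((1 / \<beta>) *\<^sub>R a)"
      unfolding antipolar_def by blast
    with a True show False
      by (simp add: inner_commute field_simps)
  next
    case False
    have nonneg: "0 \<le> a \<bullet> c" if "c \<in> C" for c
    proof (rule ccontr)
      assume neg: "\<not> 0 \<le> a \<bullet> c"
      \<comment> \<open>With \<open>a \<bullet> c < 0\<close> and \<open>\<beta> \<le> 0\<close>,
        this multiple is large enough to push the inner product down to \<beta>.\<close>
      have "\<beta> < max 1 (\<beta> / (a \<bullet> c)) * (a \<bullet> c)"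
        using that by (intro gt) auto
      also have "\<dots> \<le> \<beta> / (a \<bullet> c) * (a \<bullet> c)"
        using neg by (intro mult_right_mono_neg) auto
      finally show False
        using neg by simp
    qed
    have "1 \<le> u \<bullet> (y0 + t *\<^sub>R a)" if "0 \<le> t" for t
    proof -
      have "y0 + t *\<^sub>R a \<in> antipolar C"
        using y0 nonneg that by (force simp: antipolar_def inner_add_left intro: add_increasing2)
      with u show ?thesis
        by (auto simp: antipolar_def)
    qed
    then have *: "1 \<le> u \<bullet> y0 + t * (a \<bullet> u)" if "0 \<le> t" for t
      using that by (simp add: inner_add_right inner_commute)
    have "a \<bullet> u < 0"
      using a False by simp
    \<comment> \<open>This \<open>t\<close> makes the right-hand side of \<open>*\<close> equal to
      \<open>u \<bullet> y0 - \<bar>u \<bullet> y0\<bar>\<close>, which is at most 0.\<close>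
    with *[of "\<bar>u \<bullet> y0\<bar> / (- (a \<bullet> u))"] show False
      by (simp add: field_simps)
  qed
qed

section \<open>Subgradients of the value function\<close>

text \<open>The supporting hyperplane of \<open>W\<close> at the lowest point above the origin is not vertical, since a
  vertical one would support \<open>fst ` W\<close> at its relative interior point \<open>0\<close>.\<close>

lemma convex_lower_bound_subgradient:
  fixes W :: "('a::euclidean_space \<times> real) set"
  assumes "convex W" and ri: "0 \<in> rel_interior (fst ` W)"
    and up: "\<And>z r s. (z, r) \<in> W \<Longrightarrow> r \<le> s \<Longrightarrow> (z, s) \<in> W"
    and lb: "\<And>r. (0, r) \<in> W \<Longrightarrow> p \<le> r"
  obtains y where "\<And>z r. (z, r) \<in> W \<Longrightarrow> p \<le> r + y \<bullet> z"
proof -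
  define R where "R = {r. (0, r) \<in> W}"
  define q where "q = Inf R"
  have "0 \<in> fst ` W"
    using ri rel_interior_subset by blast
  then have R: "R \<noteq> {}" "bdd_below R"
    using lb by (auto simp: R_def intro!: bdd_belowI)
  have "p \<le> q"
    unfolding q_def using R lb by (intro cInf_greatest) (auto simp: R_def)
  have "W \<noteq> {}"
    using R by (auto simp: R_def)
  obtain r where "r \<in> R" "r < q + 1"
    using cInf_lessD[OF R(1), of "q + 1"] by (auto simp: q_def)
  then have q1: "(0, q + 1) \<in> W"
    using up[of 0 r "q + 1"] by (simp add: R_def)
  have "(0::'a, q) \<in> closure ({0} \<times> R)"
    using closure_contains_Inf[OF R] by (simp add: closure_Times q_def)
  moreover have "{0} \<times> R \<subseteq> W"
    by (auto simp: R_def)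
  ultimately have cl: "(0, q) \<in> closure W"
    using closure_mono by blast
  \<comment> \<open>From a relative interior point the segment starting at \<open>(0, q + 1)\<close>
    could be prolonged inside \<open>W\<close> to a height below the infimum
    \<open>q\<close>.\<close>
  have nri: "(0, q) \<notin> rel_interior W"
  proof
    assume "(0, q) \<in> rel_interior W"
    then obtain e where "e > 1" "(1 - e) *\<^sub>R (0, q + 1) + e *\<^sub>R (0, q) \<in> W"
      using convex_rel_interior_iff[OF \<open>convex W\<close> \<open>W \<noteq> {}\<close>] q1 by blast
    then have "q + 1 - e \<in> R"
      by (simp add: R_def algebra_simps)
    then have "q \<le> q + 1 - e"
      unfolding q_def using R by (intro cInf_lower) auto
    with \<open>e > 1\<close> show False by simp
  qed
  obtain a where le: "\<And>w. w \<in> closure W \<Longrightarrow> a \<bullet> (0, q) \<le> a \<bullet> w"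
    and less: "\<And>w. w \<in> rel_interior W \<Longrightarrow> a \<bullet> (0, q) < a \<bullet> w"
    using supporting_hyperplane_relative_frontier[OF \<open>convex W\<close> cl nri] by blast
  obtain v \<alpha> where a: "a = (v, \<alpha>)"
    by (cases a)
  have le': "\<alpha> * q \<le> v \<bullet> z + \<alpha> * r" if "(z, r) \<in> W" for z r
    using le[of "(z, r)"] that closure_subset a by auto
  have "0 \<le> \<alpha>"
    using le'[OF q1] by (simp add: algebra_simps)
  have "\<alpha> \<noteq> 0"
  proof
    assume "\<alpha> = 0"
    have "rel_interior W \<noteq> {}"
      using \<open>convex W\<close> \<open>W \<noteq> {}\<close> rel_interior_eq_empty by blast
    then obtain z r where zr: "(z, r) \<in> rel_interior W"
      by fastforce
    then have "0 < v \<bullet> z"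
      using less[of "(z, r)"] a \<open>\<alpha> = 0\<close> by simp
    have "z \<in> fst ` W"
      using zr rel_interior_subset by force
    moreover have "convex (fst ` W)"
      using \<open>convex W\<close> by (simp add: convex_linear_image linear_fst)
    \<comment> \<open>Prolonging the segment from \<open>z\<close> beyond the relative interior
      point 0 reaches a negative multiple of \<open>z\<close>, where \<open>v\<close> would be
      negative.\<close>
    ultimately obtain e where e: "e > 1" "(1 - e) *\<^sub>R z + e *\<^sub>R 0 \<in> fst ` W"
      using ri convex_rel_interior_iff[of "fst ` W" 0] by blast
    then obtain s where "((1 - e) *\<^sub>R z, s) \<in> W"
      by force
    then have "0 \<le> (1 - e) * (v \<bullet> z)"
      using le'[of "(1 - e) *\<^sub>R z" s] \<open>\<alpha> = 0\<close> by simp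
    with \<open>e > 1\<close> \<open>0 < v \<bullet> z\<close> show False
      by (simp add: zero_le_mult_iff)
  qed
  with \<open>0 \<le> \<alpha>\<close> have "\<alpha> > 0" by simp
  have "p \<le> r + ((1 / \<alpha>) *\<^sub>R v) \<bullet> z" if "(z, r) \<in> W" for z r
  proof -
    have "q \<le> r + (v \<bullet> z) / \<alpha>"
      using le'[OF that] \<open>\<alpha> > 0\<close> by (simp add: field_simps)
    with \<open>p \<le> q\<close> show ?thesis by simp
  qed
  then show thesis by (rule that)
qed

text \<open>\<open>W\<close> is the epigraph of \<kappa> over \<open>D\<close>, mapped linearly to
  pairs of a perturbation \<open>B y - A x\<close> and a level; its slice over 0 is bounded below by
  \<open>p\<close>. A subgradient there yields both claims: \<open>x = 0\<close> gives the bound on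
  \<open>D\<close>, and scaling \<open>x\<close> up gives the bound by \<kappa>. Having two maps
  \<open>A\<close> and \<open>B\<close> lets the lemma serve the primal and the dual problem
  alike.\<close>

lemma gauge_lower_bound_certificate:
  fixes A :: "'a::euclidean_space \<Rightarrow> 'c::euclidean_space" and B :: "'b::euclidean_space \<Rightarrow> 'c"
  assumes "linear A" "linear B" "is_gauge \<kappa>" "convex D"
    and x0: "x0 \<in> rel_interior (effective_domain \<kappa>)" and y0: "y0 \<in> rel_interior D"
    and eq: "A x0 = B y0"
    and lb: "\<And>x y. y \<in> D \<Longrightarrow> A x = B y \<Longrightarrow> ereal p \<le> \<kappa> x"
  obtains z where "\<And>x. ereal (z \<bullet> A x) \<le> \<kappa> x" "\<And>y. y \<in> D \<Longrightarrow> p \<le> z \<bullet> B y"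
proof -
  interpret A: linear A by fact
  interpret B: linear B by fact
  have epi: "convex (ereal_epigraph \<kappa>)" and nn: "\<And>x. 0 \<le> \<kappa> x" and \<kappa>0: "\<kappa> 0 = 0"
    using assms(3) by (auto simp: is_gauge_def)
  define F :: "('a \<times> real) \<times> 'b \<Rightarrow> 'c \<times> real"
    where "F = (\<lambda>((x, r), y). (B y - A x, r))"
  define G :: "'a \<times> 'b \<Rightarrow> 'c" where "G = (\<lambda>(x, y). B y - A x)"
  define W where "W = F ` (ereal_epigraph \<kappa> \<times> D)"
  have W: "(B y - A x, r) \<in> W" if "\<kappa> x \<le> ereal r" "y \<in> D" for x r y
    using that unfolding W_def F_def by (force simp: ereal_epigraph_def)
  have WE: "\<exists>x y. z = B y - A x \<and> \<kappa> x \<le> ereal r \<and> y \<in> D" if "(z, r) \<in> W" for z r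
    using that by (auto simp: W_def F_def ereal_epigraph_def)
  have "linear F"
    unfolding F_def by (rule linearI) (auto simp: A.add A.scaleR B.add B.scaleR algebra_simps)
  then have "convex W"
    unfolding W_def by (intro convex_linear_image convex_Times epi assms)
  have "linear G"
    unfolding G_def by (rule linearI) (auto simp: A.add A.scaleR B.add B.scaleR algebra_simps)
  have dom: "convex (effective_domain \<kappa>)"
    by (rule convex_effective_domain[OF epi])
  have fst_W: "fst ` W = G ` (effective_domain \<kappa> \<times> D)"
  proof (intro subset_antisym subsetI)
    fix z assume "z \<in> fst ` W"
    then obtain r where "(z, r) \<in> W" by force
    then obtain x y where "z = B y - A x" "\<kappa> x \<le> ereal r" "y \<in> D"
      using WE by blast
    then show "z \<in> G ` (effective_domain \<kappa> \<times> D)"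
      unfolding G_def effective_domain_def by force
  next
    fix z assume "z \<in> G ` (effective_domain \<kappa> \<times> D)"
    then obtain x y where z: "z = B y - A x" "\<kappa> x < \<infinity>" "y \<in> D"
      by (auto simp: G_def effective_domain_def)
    then obtain k where "\<kappa> x = ereal k"
      using nn[of x] by (cases "\<kappa> x") auto
    then show "z \<in> fst ` W"
      using z W[of x k y] by force
  qed
  have "(x0, y0) \<in> rel_interior (effective_domain \<kappa> \<times> D)"
    using x0 y0 by (simp add: rel_interior_Times dom assms)
  then have "G (x0, y0) \<in> rel_interior (fst ` W)"
    unfolding fst_W
    by (simp flip: rel_interior_convex_linear_image[OF \<open>linear G\<close> convex_Times[OF dom \<open>convex D\<close>]])
  then have "0 \<in> rel_interior (fst ` W)"
    using eq by (simp add: G_def)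
  moreover have "(z, s) \<in> W" if "(z, r) \<in> W" "r \<le> s" for z r s
    using WE[OF that(1)] W[of _ s] that(2) by (metis ereal_less_eq(3) order_trans)
  moreover have "p \<le> r" if zr: "(0, r) \<in> W" for r
  proof -
    obtain x y where xy: "0 = B y - A x" "\<kappa> x \<le> ereal r" "y \<in> D"
      using WE[OF zr] by blast
    then have "A x = B y" by simp
    with lb[of y x] xy show ?thesis
      by (metis ereal_less_eq(3) order_trans)
  qed
  ultimately obtain z where z: "\<And>w r. (w, r) \<in> W \<Longrightarrow> p \<le> r + z \<bullet> w"
    using convex_lower_bound_subgradient[OF \<open>convex W\<close>] by blast
  have D: "p \<le> z \<bullet> B y" if "y \<in> D" for y
    using z[OF W[of 0 0 y]] that \<kappa>0 A.zero by simp
  have "y0 \<in> D"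
    using y0 rel_interior_subset by blast
  have "ereal (z \<bullet> A x) \<le> \<kappa> x" for x
  proof (rule ereal_le_real)
    fix k assume k: "\<kappa> x \<le> ereal k"
    show "ereal (z \<bullet> A x) \<le> ereal k"
    proof (rule ccontr)
      assume "\<not> ereal (z \<bullet> A x) \<le> ereal k"
      then have pos: "0 < z \<bullet> A x - k" by simp
      \<comment> \<open>At this factor \<open>t * (z \<bullet> A x - k)\<close> exceeds the bound
        \<open>z \<bullet> B y0 - p\<close> derived below by exactly 1.\<close>
      define t where "t = (z \<bullet> B y0 - p + 1) / (z \<bullet> A x - k)"
      have "0 < t"
        unfolding t_def using pos D[OF \<open>y0 \<in> D\<close>] by (intro divide_pos_pos) auto
      have "p \<le> t * k + z \<bullet> (B y0 - A (t *\<^sub>R x))"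
        by (intro z W is_gauge_scale_le assms) (use k \<open>0 < t\<close> \<open>y0 \<in> D\<close> in auto)
      then have "t * (z \<bullet> A x - k) \<le> z \<bullet> B y0 - p"
        by (simp add: A.scaleR inner_diff_right algebra_simps)
      then show False
        using pos by (simp add: t_def)
    qed
  qed
  then show thesis
    using D by (rule that)
qed

section \<open>The residual set\<close>

lemma residual_set_eq_image: "residual_set b \<rho> \<sigma> = (\<lambda>v. b - v) ` {v. \<rho> v \<le> ereal \<sigma>}"
  by (force simp: residual_set_def image_iff intro: exI[of _ "b - _"])

text \<open>Membership in the antipolar bounds \<open>v \<bullet> y\<close> by
  \<open>y \<bullet> b - 1\<close> on the \<sigma>-sublevel set of \<rho>. For positive \<sigma>
  this is a bound on the polar; for \<open>\<sigma> = 0\<close> that sublevel set is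
  \<open>{0}\<close> and both sides say \<open>1 \<le> y \<bullet> b\<close>.\<close>

lemma antipolar_residual_set_eq_dual_feasible:
  assumes "is_gauge \<rho>" "0 \<le> \<sigma>" "\<sigma> = 0 \<Longrightarrow> \<rho> -` {0} = {0}"
  shows "antipolar (residual_set b \<rho> \<sigma>) = dual_feasible b \<rho> \<sigma>"
proof -
  have nn: "\<And>x. 0 \<le> \<rho> x"
    using assms by (simp add: is_gauge_def)
  have antipolar_iff: "y \<in> antipolar (residual_set b \<rho> \<sigma>) \<longleftrightarrow>
      (\<forall>v. \<rho> v \<le> ereal \<sigma> \<longrightarrow> v \<bullet> y \<le> y \<bullet> b - 1)" for y
  proof -
    have "y \<in> antipolar (residual_set b \<rho> \<sigma>) \<longleftrightarrow> (\<forall>v. \<rho> v \<le> ereal \<sigma> \<longrightarrow> 1 \<le> y \<bullet> (b - v))"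
      by (auto simp: antipolar_def residual_set_eq_image)
    then show ?thesis
      by (simp add: inner_diff_right inner_commute algebra_simps)
  qed
  have "y \<in> antipolar (residual_set b \<rho> \<sigma>) \<longleftrightarrow> y \<in> dual_feasible b \<rho> \<sigma>" for y
  proof (cases "\<sigma> = 0")
    case True
    have "\<rho> v \<le> 0 \<longleftrightarrow> v = 0" for v
      using assms(3)[OF True] nn[of v] by (metis antisym order_refl vimage_singleton_eq singleton_iff)
    with True show ?thesis
      by (simp add: antipolar_iff[unfolded True] dual_feasible_def one_ereal_def flip: zero_ereal_def)
  next
    case False
    with assms have "0 < \<sigma>" by simp
    have "y \<in> antipolar (residual_set b \<rho> \<sigma>) \<longleftrightarrow> polar_gauge \<rho> y \<le> ereal ((y \<bullet> b - 1) / \<sigma>)"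
      by (simp add: antipolar_iff polar_gauge_le_sublevel_iff[OF assms(1) \<open>0 < \<sigma>\<close>])
    also have "\<dots> \<longleftrightarrow> y \<in> dual_feasible b \<rho> \<sigma>"
      using \<open>0 < \<sigma>\<close> polar_gauge_nonneg[of \<rho> y]
      by (cases "polar_gauge \<rho> y") (auto simp: dual_feasible_def one_ereal_def field_simps)
    finally show ?thesis .
  qed
  then show ?thesis by blast
qed

lemma closed_convex_residual_set:
  assumes "closed_gauge \<rho>"
  shows "closed (residual_set b \<rho> \<sigma>)" "convex (residual_set b \<rho> \<sigma>)"
proof -
  have "residual_set b \<rho> \<sigma> = (\<lambda>u. b - u) -` {v. \<rho> v \<le> ereal \<sigma>}"
    by (auto simp: residual_set_def)
  moreover have "closed ((\<lambda>u. b - u) -` {v. \<rho> v \<le> ereal \<sigma>})"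
    by (intro closed_vimage closed_gauge_sublevel(1)[OF assms] continuous_intros)
  ultimately show "closed (residual_set b \<rho> \<sigma>)"
    by simp
  show "convex (residual_set b \<rho> \<sigma>)"
    using convex_affinity[OF closed_gauge_sublevel(2)[OF assms], of b "-1" \<sigma>]
    by (simp add: residual_set_eq_image)
qed

section \<open>Weak and strong duality for the pair of gauge problems\<close>

lemma weak_gauge_duality:
  fixes A :: "'a::euclidean_space \<Rightarrow> 'b::euclidean_space"
  assumes "linear A" "is_gauge \<kappa>" "y \<in> antipolar C" "A x \<in> C"
    and "polar_gauge \<kappa> (adjoint A y) \<le> ereal m" "\<kappa> x \<le> ereal k"
  shows "1 \<le> m * k"
proof -
  have "1 \<le> y \<bullet> A x"
    using assms by (auto simp: antipolar_def)
  also have "\<dots> = x \<bullet> adjoint A y"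
    by (simp add: adjoint_works[OF assms(1)] inner_commute)
  also have "\<dots> \<le> m * k"
    using assms by (intro inner_le_polar_gauge[of \<kappa>]) (auto simp: is_gauge_def)
  finally show ?thesis .
qed

theorem corollary5p6:
  fixes A :: "'a::euclidean_space \<Rightarrow> 'b::euclidean_space"
    and b :: 'b
    and \<kappa> :: "'a \<Rightarrow> ereal"
    and \<rho> :: "'b \<Rightarrow> ereal"
    and \<sigma> :: real
  assumes "linear A"
    and "closed_gauge \<kappa>"
    and "closed_gauge \<rho>"
    and "0 \<le> \<sigma>"
    and "ereal \<sigma> < \<rho> b"
    and "\<sigma> = 0 \<Longrightarrow> \<rho> -` {0} = {0}"
    and "rel_interior (effective_domain \<kappa>) \<inter> A -` rel_interior (residual_set b \<rho> \<sigma>) \<noteq> {}"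
    and "rel_interior (effective_domain (polar_gauge \<kappa>)) \<inter>
           adjoint A ` rel_interior (antipolar (residual_set b \<rho> \<sigma>)) \<noteq> {}"
  shows "optimal_value_attained \<kappa> (primal_feasible A b \<rho> \<sigma>) \<and>
         optimal_value_attained (\<lambda>y. polar_gauge \<kappa> (adjoint A y)) (dual_feasible b \<rho> \<sigma>) \<and>
         optimal_value \<kappa> (primal_feasible A b \<rho> \<sigma>) *
           optimal_value (\<lambda>y. polar_gauge \<kappa> (adjoint A y)) (dual_feasible b \<rho> \<sigma>) = 1"
proof -
  define C where "C = residual_set b \<rho> \<sigma>"
  define D where "D = antipolar C"
  have \<kappa>: "is_gauge \<kappa>" and \<rho>: "is_gauge \<rho>"
    using assms(2,3) by (auto simp: closed_gauge_def)
  have nn: "\<And>x. 0 \<le> \<kappa> x"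
    using \<kappa> by (auto simp: is_gauge_def)
  have C: "closed C" "convex C"
    unfolding C_def by (rule closed_convex_residual_set[OF assms(3)])+
  have "0 \<notin> C"
    using assms(5) by (simp add: C_def residual_set_def)
  have feasible: "primal_feasible A b \<rho> \<sigma> = {x. A x \<in> C}" "dual_feasible b \<rho> \<sigma> = D"
    using antipolar_residual_set_eq_dual_feasible[OF \<rho> assms(4,6)]
    by (auto simp: primal_feasible_def residual_set_def C_def D_def)
  obtain x0 where x0: "x0 \<in> rel_interior (effective_domain \<kappa>)" "A x0 \<in> rel_interior C"
    using assms(7) by (auto simp: C_def)
  obtain y0 where y0: "adjoint A y0 \<in> rel_interior (effective_domain (polar_gauge \<kappa>))"
      "y0 \<in> rel_interior D"
    using assms(8) by (auto simp: C_def D_def)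
  have "A x0 \<in> C" "x0 \<in> effective_domain \<kappa>" "y0 \<in> D"
      "adjoint A y0 \<in> effective_domain (polar_gauge \<kappa>)"
    using x0 y0 rel_interior_subset by blast+
  then obtain k0 m0 where k0: "\<kappa> x0 = ereal k0" and m0: "polar_gauge \<kappa> (adjoint A y0) = ereal m0"
    using nn[of x0] polar_gauge_nonneg[of \<kappa> "adjoint A y0"]
    by (cases "\<kappa> x0"; cases "polar_gauge \<kappa> (adjoint A y0)") (auto simp: effective_domain_def)
  \<comment> \<open>Testing \<open>y\<close> against \<open>x0\<close>, whose value is finite,
    excludes \<open>m = 0\<close>.\<close>
  have weak: "0 < m \<and> ereal (1 / m) \<le> \<kappa> x"
    if "y \<in> D" "A x \<in> C" "polar_gauge \<kappa> (adjoint A y) = ereal m" for x y m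
  proof -
    have "1 \<le> m * k0"
      using that k0 \<open>A x0 \<in> C\<close>
      by (intro weak_gauge_duality[OF assms(1) \<kappa>, of y C x0]) (auto simp: D_def)
    moreover have "0 \<le> m"
      using polar_gauge_nonneg[of \<kappa> "adjoint A y"] that by simp
    ultimately have "0 < m"
      by (cases "m = 0") auto
    moreover have "ereal (1 / m) \<le> \<kappa> x"
    proof (rule ereal_le_real)
      fix k assume "\<kappa> x \<le> ereal k"
      then have "1 \<le> m * k"
        using that by (intro weak_gauge_duality[OF assms(1) \<kappa>, of y C x]) (auto simp: D_def)
      with \<open>0 < m\<close> show "ereal (1 / m) \<le> ereal k"
        by (simp add: field_simps)
    qed
    ultimately show ?thesis by blast
  qed
  define P where "P = (INF x\<in>{x. A x \<in> C}. \<kappa> x)"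
  have P_le: "P \<le> \<kappa> x" if "A x \<in> C" for x
    unfolding P_def using that by (auto intro: INF_lower)
  have P_ge: "ereal (1 / m) \<le> P" if "y \<in> D" "polar_gauge \<kappa> (adjoint A y) = ereal m" for y m
    unfolding P_def using weak[OF that(1) _ that(2)] by (auto intro: INF_greatest)
  have "0 < m0"
    using weak[OF \<open>y0 \<in> D\<close> \<open>A x0 \<in> C\<close> m0] by simp
  then have "0 < P"
    using less_le_trans[OF _ P_ge[OF \<open>y0 \<in> D\<close> m0], of 0] by simp
  then obtain p where p: "P = ereal p" "0 < p"
    using P_le[OF \<open>A x0 \<in> C\<close>] k0 by (cases P) auto

  \<comment> \<open>Dual attainment: the certificate is taken for \<open>A\<close>, the identity and
    \<open>C\<close>; dividing it by \<open>p\<close> makes it dual feasible.\<close>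
  have "ereal p \<le> \<kappa> x" if "u \<in> C" "A x = id u" for x u
    using P_le[of x] p that by simp
  then obtain z where z: "\<And>x. ereal (z \<bullet> A x) \<le> \<kappa> x" "\<And>u. u \<in> C \<Longrightarrow> p \<le> z \<bullet> id u"
    using gauge_lower_bound_certificate[OF assms(1) linear_id \<kappa> C(2) x0] by (metis id_apply)
  define y1 where "y1 = (1 / p) *\<^sub>R z"
  have "y1 \<in> D"
    using z(2) p by (auto simp: D_def antipolar_def y1_def field_simps)
  have "polar_gauge \<kappa> (adjoint A y1) \<le> ereal (1 / p)"
    unfolding polar_gauge_le_iff[of \<kappa>, OF nn]
  proof (intro conjI allI impI)
    fix x k assume "\<kappa> x \<le> ereal k"
    then have "z \<bullet> A x \<le> k"
      using z(1)[of x] by (metis ereal_less_eq(3) order_trans)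
    then show "x \<bullet> adjoint A y1 \<le> 1 / p * k"
      using p by (simp add: adjoint_works[OF assms(1)] y1_def inner_commute divide_right_mono)
  qed (use p in simp)
  \<comment> \<open>A finite dual value \<open>m\<close> bounds \<open>P\<close> below by
    \<open>1 / m\<close>, hence \<open>m \<ge> 1 / p\<close>.\<close>
  moreover have dual_ge: "ereal (1 / p) \<le> polar_gauge \<kappa> (adjoint A y)" if "y \<in> D" for y
  proof (cases "polar_gauge \<kappa> (adjoint A y)")
    case (real m)
    have "0 < m" "1 / m \<le> p"
      using weak[OF that \<open>A x0 \<in> C\<close> real] P_ge[OF that real] p by auto
    with real p show ?thesis
      by (simp add: field_simps)
  next
    case PInf
    then show ?thesis by simp
  next
    case MInf
    then show ?thesis using polar_gauge_nonneg[of \<kappa> "adjoint A y"] by simp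
  qed
  ultimately have y1: "polar_gauge \<kappa> (adjoint A y1) = ereal (1 / p)"
    using \<open>y1 \<in> D\<close> by (blast intro: antisym)
  have dual: "optimal_value (\<lambda>y. polar_gauge \<kappa> (adjoint A y)) D = ereal (1 / p)"
    unfolding optimal_value_def
    by (rule antisym) (use dual_ge y1 INF_lower[OF \<open>y1 \<in> D\<close>, of "\<lambda>y. polar_gauge \<kappa> (adjoint A y)"]
      in \<open>auto intro: INF_greatest\<close>)

  \<comment> \<open>Primal attainment: now the identity takes the place of \<open>A\<close>,
    \<open>adjoint A\<close> that of \<open>B\<close>, and the bound is
    \<open>1 / p\<close>.\<close>
  have "ereal (1 / p) \<le> polar_gauge \<kappa> w" if "y \<in> D" "id w = adjoint A y" for w y
    using dual_ge that by simp
  then obtain x where x: "\<And>w. ereal (x \<bullet> id w) \<le> polar_gauge \<kappa> w"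
      "\<And>y. y \<in> D \<Longrightarrow> 1 / p \<le> x \<bullet> adjoint A y"
    using gauge_lower_bound_certificate[OF linear_id adjoint_linear[OF assms(1)]
        is_gauge_polar_gauge[OF \<kappa>] convex_antipolar y0[unfolded D_def]]
    unfolding D_def by (metis id_apply)
  have "\<kappa> x \<le> ereal 1"
    using le_one_of_inner_le_polar_gauge[OF assms(2)] x(1) by (simp add: one_ereal_def)
  have "p *\<^sub>R A x \<in> antipolar (antipolar C)"
    using x(2) p by (auto simp: adjoint_works[OF assms(1)] antipolar_def D_def field_simps)
  then obtain l c where lc: "p *\<^sub>R A x = l *\<^sub>R c" "1 \<le> l" "c \<in> C"
    using antipolar_antipolar_subset[OF C \<open>0 \<notin> C\<close>, of y0] \<open>y0 \<in> D\<close> unfolding D_def by blast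
  \<comment> \<open>The factor \<open>p\<close> makes up for the bound \<open>1 / p\<close>, and
    dividing by \<open>l\<close> brings the image back to \<open>c \<in> C\<close>; as
    \<open>l \<ge> 1\<close>, the value stays at most \<open>p\<close>.\<close>
  define x1 where "x1 = (p / l) *\<^sub>R x"
  have "A x1 = (1 / l) *\<^sub>R p *\<^sub>R A x"
    by (simp add: x1_def linear_scale[OF assms(1)])
  also have "\<dots> = c"
    using lc by simp
  finally have "A x1 \<in> C"
    using lc by simp
  have "\<kappa> x1 \<le> ereal (p / l * 1)"
    unfolding x1_def using lc p \<open>\<kappa> x \<le> ereal 1\<close> by (intro is_gauge_scale_le \<kappa>) auto
  also have "\<dots> \<le> ereal p"
    using lc p by (simp add: divide_le_eq)
  finally have "\<kappa> x1 = P"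
    using P_le[OF \<open>A x1 \<in> C\<close>] p by simp
  then show ?thesis
    unfolding feasible optimal_value_attained_def dual
    using \<open>A x1 \<in> C\<close> \<open>y1 \<in> D\<close> y1 p
    by (auto simp: optimal_value_def one_ereal_def simp flip: P_def)
qed

end
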